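(* For each object $(S,R)$ of $\mathcal{E}$, let $j_{(S,R)}:\psi_{(S,R)}(N(S))\to R$ be the inclusion. Then $j=(j_{(S,R)})_{(S,R)\in \mathrm{Ob}\,\mathcal{E}}$ is a natural transformation from the functor $\chi$ to the functor $V$ (both regarded as functors from $\mathcal{E}$ to $\mathcal{CR}$).
   Context: "Ring" means commutative ring, not necessarily with identity; $\mathcal{CR}$ is the category of commutative rings and ring homomorphisms (maps respecting addition and product). Prime ideals are proper by definition. $N(S)$ denotes the nilradical of a ring $S$, i.e. the intersection of all prime ideals of $S$ (equal to $S$ if there are none). An i-extension of $S$ is a ring $R$ containing $S$ as an ideal. For an i-extension $R$ of $S$ and an ideal $I$ of $S$, put $\psi_{(S,R)}(I)=\{x\in R: xS\subseteq I\}$, an ideal of $R$. $\mathcal{E}$ is the category whose objects are the pairs $(S,R)$ with $R$ a unitary ring that is an i-extension of the ring $S$, and whose morphisms $(S_1,R_1)\to(S_2,R_2)$ are the homomorphisms of unitary rings $h:R_1\to R_2$ such that $h(S_1)=S_2$. The functor $V$ sends $h:(S,R)\to(T,M)$ to $h:R\to M$. The functor $\chi:\mathcal{E}\to\mathcal{CR}$ sends $(S,R)$ to the ring $\psi_{(S,R)}(N(S))$ and a morphism $h:(S,R)\to(T,M)$ to the restriction $h|_{\psi_{(S,R)}(N(S))}:\psi_{(S,R)}(N(S))\to\psi_{(T,M)}(N(T))$. *)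

theory Defs
  imports "HOL-Algebra.Ideal"
begin

section \<open>Categories, functors, natural transformations\<close>

text \<open>
  Composition \<open>Comp C g f\<close> (first \<open>f\<close>, then \<open>g\<close>) is a total function in HOL; only its values on
  composable pairs of arrows are constrained.
\<close>

record ('o, 'm) cat =
  Obj :: "'o set"
  Arr :: "'m set"
  Dom :: "'m \<Rightarrow> 'o"
  Cod :: "'m \<Rightarrow> 'o"
  Ident :: "'o \<Rightarrow> 'm"
  Comp :: "'m \<Rightarrow> 'm \<Rightarrow> 'm"

locale category =
  fixes C :: "('o, 'm) cat"
  assumes Dom_Obj: "f \<in> Arr C \<Longrightarrow> Dom C f \<in> Obj C"
    and Cod_Obj: "f \<in> Arr C \<Longrightarrow> Cod C f \<in> Obj C"
    and Ident_Arr: "x \<in> Obj C \<Longrightarrow> Ident C x \<in> Arr C"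
    and Dom_Ident: "x \<in> Obj C \<Longrightarrow> Dom C (Ident C x) = x"
    and Cod_Ident: "x \<in> Obj C \<Longrightarrow> Cod C (Ident C x) = x"
    and Comp_Arr: "\<lbrakk>f \<in> Arr C; g \<in> Arr C; Cod C f = Dom C g\<rbrakk> \<Longrightarrow> Comp C g f \<in> Arr C"
    and Dom_Comp: "\<lbrakk>f \<in> Arr C; g \<in> Arr C; Cod C f = Dom C g\<rbrakk> \<Longrightarrow> Dom C (Comp C g f) = Dom C f"
    and Cod_Comp: "\<lbrakk>f \<in> Arr C; g \<in> Arr C; Cod C f = Dom C g\<rbrakk> \<Longrightarrow> Cod C (Comp C g f) = Cod C g"
    and Comp_Ident: "f \<in> Arr C \<Longrightarrow> Comp C f (Ident C (Dom C f)) = f"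
    and Ident_Comp: "f \<in> Arr C \<Longrightarrow> Comp C (Ident C (Cod C f)) f = f"
    and Comp_assoc: "\<lbrakk>f \<in> Arr C; g \<in> Arr C; h \<in> Arr C; Cod C f = Dom C g; Cod C g = Dom C h\<rbrakk>
      \<Longrightarrow> Comp C h (Comp C g f) = Comp C (Comp C h g) f"

record ('o1, 'm1, 'o2, 'm2) functor_data =
  obj_map :: "'o1 \<Rightarrow> 'o2"
  arr_map :: "'m1 \<Rightarrow> 'm2"

locale cat_functor = C: category C + D: category D
  for C :: "('o1, 'm1) cat" and D :: "('o2, 'm2) cat" +
  fixes F :: "('o1, 'm1, 'o2, 'm2) functor_data"
  assumes obj_map_Obj: "x \<in> Obj C \<Longrightarrow> obj_map F x \<in> Obj D"
    and arr_map_Arr: "f \<in> Arr C \<Longrightarrow> arr_map F f \<in> Arr D"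
    and Dom_arr_map: "f \<in> Arr C \<Longrightarrow> Dom D (arr_map F f) = obj_map F (Dom C f)"
    and Cod_arr_map: "f \<in> Arr C \<Longrightarrow> Cod D (arr_map F f) = obj_map F (Cod C f)"
    and arr_map_Ident: "x \<in> Obj C \<Longrightarrow> arr_map F (Ident C x) = Ident D (obj_map F x)"
    and arr_map_Comp: "\<lbrakk>f \<in> Arr C; g \<in> Arr C; Cod C f = Dom C g\<rbrakk>
      \<Longrightarrow> arr_map F (Comp C g f) = Comp D (arr_map F g) (arr_map F f)"

locale natural_transformation = F: cat_functor C D F + G: cat_functor C D G
  for C :: "('o1, 'm1) cat" and D :: "('o2, 'm2) cat"
    and F G :: "('o1, 'm1, 'o2, 'm2) functor_data" +
  fixes \<eta> :: "'o1 \<Rightarrow> 'm2"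
  assumes component_Arr: "x \<in> Obj C \<Longrightarrow> \<eta> x \<in> Arr D"
    and Dom_component: "x \<in> Obj C \<Longrightarrow> Dom D (\<eta> x) = obj_map F x"
    and Cod_component: "x \<in> Obj C \<Longrightarrow> Cod D (\<eta> x) = obj_map G x"
    and naturality: "f \<in> Arr C
      \<Longrightarrow> Comp D (\<eta> (Cod C f)) (arr_map F f) = Comp D (arr_map G f) (\<eta> (Dom C f))"

text \<open>
  Categories of sets with structure. An arrow records its source and target; its underlying
  function is taken extensional on the carrier of the source, so that equality of arrows is
  equality of maps of sets.
\<close>

datatype ('o, 'a) arrow = Arrow (source: 'o) (target: 'o) (fn: "'a \<Rightarrow> 'a")

definition concrete_cat ::
  "'o set \<Rightarrow> ('o \<Rightarrow> 'a set) \<Rightarrow> ('o \<Rightarrow> 'o \<Rightarrow> ('a \<Rightarrow> 'a) set) \<Rightarrow> ('o, ('o, 'a) arrow) cat" where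
  "concrete_cat X U H = \<lparr>
     Obj = X,
     Arr = {Arrow x y f | x y f. x \<in> X \<and> y \<in> X \<and> f \<in> H x y \<inter> extensional (U x)},
     Dom = source,
     Cod = target,
     Ident = (\<lambda>x. Arrow x x (\<lambda>a\<in>U x. a)),
     Comp = (\<lambda>g f. Arrow (source f) (target g) (compose (U (source f)) (fn g) (fn f)))\<rparr>"


section \<open>Commutative rings not necessarily with identity\<close>

text \<open>
  The ring records of HOL-Algebra are reused; the field \<open>one\<close> carries no information here and
  is not mentioned by any of the notions of this section.
\<close>

locale comm_rng = abelian_group R for R (structure) +
  assumes rng_m_closed: "\<lbrakk>x \<in> carrier R; y \<in> carrier R\<rbrakk> \<Longrightarrow> x \<otimes> y \<in> carrier R"
    and rng_m_assoc: "\<lbrakk>x \<in> carrier R; y \<in> carrier R; z \<in> carrier R\<rbrakk>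
      \<Longrightarrow> (x \<otimes> y) \<otimes> z = x \<otimes> (y \<otimes> z)"
    and rng_m_comm: "\<lbrakk>x \<in> carrier R; y \<in> carrier R\<rbrakk> \<Longrightarrow> x \<otimes> y = y \<otimes> x"
    and rng_l_distr: "\<lbrakk>x \<in> carrier R; y \<in> carrier R; z \<in> carrier R\<rbrakk>
      \<Longrightarrow> (x \<oplus> y) \<otimes> z = x \<otimes> z \<oplus> y \<otimes> z"

definition rng_hom :: "('a, 'm) ring_scheme \<Rightarrow> ('b, 'n) ring_scheme \<Rightarrow> ('a \<Rightarrow> 'b) set" where
  "rng_hom R M = {h \<in> carrier R \<rightarrow> carrier M. \<forall>x\<in>carrier R. \<forall>y\<in>carrier R.
     h (x \<oplus>\<^bsub>R\<^esub> y) = h x \<oplus>\<^bsub>M\<^esub> h y \<and> h (x \<otimes>\<^bsub>R\<^esub> y) = h x \<otimes>\<^bsub>M\<^esub> h y}"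

text \<open>The library locale \<open>ideal\<close> is not applicable: it presupposes a ring with identity.\<close>

locale rng_ideal = additive_subgroup I R + comm_rng R for I and R (structure) +
  assumes rng_I_closed: "\<lbrakk>a \<in> I; x \<in> carrier R\<rbrakk> \<Longrightarrow> x \<otimes> a \<in> I"

locale rng_primeideal = rng_ideal P R for P and R (structure) +
  assumes rng_P_proper: "P \<noteq> carrier R"
    and rng_P_prime: "\<lbrakk>a \<in> carrier R; b \<in> carrier R; a \<otimes> b \<in> P\<rbrakk> \<Longrightarrow> a \<in> P \<or> b \<in> P"

text \<open>Intersecting with the carrier gives the convention \<open>N(S) = S\<close> when there are no primes.\<close>

definition nilradical :: "('a, 'm) ring_scheme \<Rightarrow> 'a set" where
  "nilradical S = carrier S \<inter> \<Inter>{P. rng_primeideal P S}"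

lemma cring_imp_comm_rng:
  assumes "cring R" shows "comm_rng R"
proof -
  interpret cring R by fact
  show ?thesis
    by unfold_locales (auto simp: m_assoc l_distr intro: m_comm)
qed

lemma rng_ideal_iff_ideal:
  assumes "cring R"
  shows "rng_ideal I R \<longleftrightarrow> ideal I R"
proof -
  interpret cring R by fact
  interpret comm_rng R using assms by (rule cring_imp_comm_rng)
  show ?thesis
  proof
    assume "rng_ideal I R"
    then interpret rng_ideal I R .
    show "ideal I R"
      by unfold_locales (use rng_I_closed m_comm a_Hcarr in \<open>metis\<close>)+
  next
    assume "ideal I R"
    then interpret ideal I R .
    show "rng_ideal I R"
      by unfold_locales (rule I_l_closed)
  qed
qed

lemma rng_primeideal_iff_primeideal:
  assumes "cring R"
  shows "rng_primeideal P R \<longleftrightarrow> primeideal P R"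
  using assms rng_ideal_iff_ideal[OF assms, of P]
  unfolding rng_primeideal_def rng_primeideal_axioms_def primeideal_def primeideal_axioms_def
  by blast


section \<open>I-extensions and the category of pairs\<close>

locale i_extension = S: comm_rng S + R: comm_rng R
  for S :: "'a ring" and R :: "'a ring" +
  assumes carrier_ideal: "rng_ideal (carrier S) R"
    and mult_eq: "\<lbrakk>x \<in> carrier S; y \<in> carrier S\<rbrakk> \<Longrightarrow> x \<otimes>\<^bsub>S\<^esub> y = x \<otimes>\<^bsub>R\<^esub> y"
    and add_eq: "\<lbrakk>x \<in> carrier S; y \<in> carrier S\<rbrakk> \<Longrightarrow> x \<oplus>\<^bsub>S\<^esub> y = x \<oplus>\<^bsub>R\<^esub> y"
    and zero_eq: "\<zero>\<^bsub>S\<^esub> = \<zero>\<^bsub>R\<^esub>"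

definition psi :: "'a ring \<times> 'a ring \<Rightarrow> 'a set \<Rightarrow> 'a set" where
  "psi = (\<lambda>(S, R) I. {x \<in> carrier R. \<forall>s\<in>carrier S. x \<otimes>\<^bsub>R\<^esub> s \<in> I})"

text \<open>
  The type variable plays the role of the universe: the objects are the rings whose elements
  belong to \<open>'a\<close>.
\<close>

definition CR :: "('a ring, ('a ring, 'a) arrow) cat" where
  "CR = concrete_cat {R. comm_rng R} carrier rng_hom"

definition E_cat :: "('a ring \<times> 'a ring, ('a ring \<times> 'a ring, 'a) arrow) cat" where
  "E_cat = concrete_cat {(S, R). cring R \<and> i_extension S R} (\<lambda>(S, R). carrier R)
     (\<lambda>(S1, R1) (S2, R2). {h \<in> ring_hom R1 R2. h ` carrier S1 = carrier S2})"

definition V_functor ::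
  "('a ring \<times> 'a ring, ('a ring \<times> 'a ring, 'a) arrow, 'a ring, ('a ring, 'a) arrow) functor_data" where
  "V_functor = \<lparr>
     obj_map = snd,
     arr_map = (\<lambda>f. Arrow (snd (source f)) (snd (target f)) (fn f))\<rparr>"

definition chi_obj :: "'a ring \<times> 'a ring \<Rightarrow> 'a ring" where
  "chi_obj = (\<lambda>(S, R). R\<lparr>carrier := psi (S, R) (nilradical S)\<rparr>)"

definition chi_functor ::
  "('a ring \<times> 'a ring, ('a ring \<times> 'a ring, 'a) arrow, 'a ring, ('a ring, 'a) arrow) functor_data" where
  "chi_functor = \<lparr>
     obj_map = chi_obj,
     arr_map = (\<lambda>f. Arrow (chi_obj (source f)) (chi_obj (target f))
                  (restrict (fn f) (carrier (chi_obj (source f)))))\<rparr>"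

definition j_inclusion :: "'a ring \<times> 'a ring \<Rightarrow> ('a ring, 'a) arrow" where
  "j_inclusion = (\<lambda>(S, R). Arrow (chi_obj (S, R)) R (\<lambda>x\<in>psi (S, R) (nilradical S). x))"

end

theory Submission
  imports Defs
begin

text \<open>
  The only step with content is that \<open>\<chi>\<close> is well defined on arrows. If \<open>h\<close> maps \<open>S\<close> onto \<open>T\<close>,
  then preimages under \<open>h\<close> of primes of \<open>T\<close> are primes of \<open>S\<close> (surjectivity keeps them proper),
  so \<open>h (N S) \<subseteq> N T\<close>; and for \<open>x S \<subseteq> N S\<close> every \<open>t \<in> T\<close> is some \<open>h s\<close>, whence
  \<open>h x \<cdot> t = h (x s) \<in> N T\<close>.
\<close>

section \<open>Concrete categories, and functors that restrict maps\<close>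

text \<open>\<open>funcset\<close> is what the left unit law and associativity rest on: outside
  \<open>U y\<close> the extensional identity and the inner composite are \<open>undefined\<close>,
  so a map into \<open>U y\<close> must really land there.\<close>

lemma category_concrete_cat:
  assumes funcset: "\<And>x y f. \<lbrakk>x \<in> X; y \<in> X; f \<in> H x y\<rbrakk> \<Longrightarrow> f \<in> U x \<rightarrow> U y"
    and ident: "\<And>x. x \<in> X \<Longrightarrow> (\<lambda>a\<in>U x. a) \<in> H x x"
    and comp: "\<And>x y z f g. \<lbrakk>x \<in> X; y \<in> X; z \<in> X; f \<in> H x y; g \<in> H y z\<rbrakk>
      \<Longrightarrow> compose (U x) g f \<in> H x z"
  shows "category (concrete_cat X U H)"
proof
  fix f g h
  assume "f \<in> Arr (concrete_cat X U H)" "g \<in> Arr (concrete_cat X U H)"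
    "Cod (concrete_cat X U H) f = Dom (concrete_cat X U H) g"
  then show "Comp (concrete_cat X U H) g f \<in> Arr (concrete_cat X U H)"
    by (auto simp: concrete_cat_def intro: comp)
next
  fix f assume "f \<in> Arr (concrete_cat X U H)"
  then obtain x y f' where f: "f = Arrow x y f'" "x \<in> X" "y \<in> X" "f' \<in> H x y"
      "f' \<in> extensional (U x)"
    by (auto simp: concrete_cat_def)
  show "Comp (concrete_cat X U H) f
      (Ident (concrete_cat X U H) (Dom (concrete_cat X U H) f)) = f"
    using f by (auto simp: concrete_cat_def compose_def fun_eq_iff extensional_def)
  show "Comp (concrete_cat X U H)
      (Ident (concrete_cat X U H) (Cod (concrete_cat X U H) f)) f = f"
    using f funcset[of x y f'] by (auto simp: concrete_cat_def compose_def fun_eq_iff extensional_def Pi_iff)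
next
  fix f g h
  assume "f \<in> Arr (concrete_cat X U H)" "g \<in> Arr (concrete_cat X U H)"
    "h \<in> Arr (concrete_cat X U H)"
    "Cod (concrete_cat X U H) f = Dom (concrete_cat X U H) g"
    "Cod (concrete_cat X U H) g = Dom (concrete_cat X U H) h"
  then show "Comp (concrete_cat X U H) h (Comp (concrete_cat X U H) g f) =
      Comp (concrete_cat X U H) (Comp (concrete_cat X U H) h g) f"
    by (auto simp: concrete_cat_def intro!: compose_assoc dest: funcset[THEN funcset_mem])
qed (auto simp: concrete_cat_def intro: ident)

text \<open>Common pattern of \<open>chi_functor\<close> and \<open>V_functor\<close>: an arrow is
  sent to its restriction to the carrier of the image object. By \<open>sub\<close> and
  \<open>funcset'\<close>, restricting commutes with identities and composites.\<close>

lemma cat_functor_concrete_restrict: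
  assumes C: "category (concrete_cat X U H)" and D: "category (concrete_cat Y W K)"
    and funcset: "\<And>x y f. \<lbrakk>x \<in> X; y \<in> X; f \<in> H x y\<rbrakk> \<Longrightarrow> f \<in> U x \<rightarrow> U y"
    and obj: "\<And>x. x \<in> X \<Longrightarrow> obj_map F x \<in> Y"
    and sub: "\<And>x. x \<in> X \<Longrightarrow> W (obj_map F x) \<subseteq> U x"
    and funcset': "\<And>x y f. \<lbrakk>x \<in> X; y \<in> X; f \<in> H x y\<rbrakk>
      \<Longrightarrow> f \<in> W (obj_map F x) \<rightarrow> W (obj_map F y)"
    and arr: "\<And>x y f. \<lbrakk>x \<in> X; y \<in> X; f \<in> H x y\<rbrakk>
      \<Longrightarrow> restrict f (W (obj_map F x)) \<in> K (obj_map F x) (obj_map F y)"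
    and arr_map: "\<And>x y f. \<lbrakk>x \<in> X; y \<in> X; f \<in> extensional (U x)\<rbrakk>
      \<Longrightarrow> arr_map F (Arrow x y f)
        = Arrow (obj_map F x) (obj_map F y) (restrict f (W (obj_map F x)))"
  shows "cat_functor (concrete_cat X U H) (concrete_cat Y W K) F"
proof -
  interpret C: category "concrete_cat X U H" by (rule C)
  interpret D: category "concrete_cat Y W K" by (rule D)
  show ?thesis
  proof
    fix x assume "x \<in> Obj (concrete_cat X U H)"
    then have x: "x \<in> X" by (simp add: concrete_cat_def)
    show "arr_map F (Ident (concrete_cat X U H) x) = Ident (concrete_cat Y W K) (obj_map F x)"
      using x sub[OF x] by (auto simp: concrete_cat_def arr_map fun_eq_iff)
  next
    fix f g
    assume fg: "f \<in> Arr (concrete_cat X U H)" "g \<in> Arr (concrete_cat X U H)"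
      "Cod (concrete_cat X U H) f = Dom (concrete_cat X U H) g"
    then obtain x y z f' g' where
        eqs: "f = Arrow x y f'" "g = Arrow y z g'" and obs: "x \<in> X" "y \<in> X" "z \<in> X"
        and homs: "f' \<in> H x y" "g' \<in> H y z"
        and ext: "f' \<in> extensional (U x)" "g' \<in> extensional (U y)"
      by (auto simp: concrete_cat_def)
    \<comment> \<open>The rule \<open>arr_map\<close> covers extensional maps only, so the composite
      has to be known as one.\<close>
    have "compose (U x) g' f' \<in> extensional (U x)" by simp
    then show "arr_map F (Comp (concrete_cat X U H) g f) =
        Comp (concrete_cat Y W K) (arr_map F g) (arr_map F f)"
      using obs ext sub[OF obs(1)] funcset'[OF obs(1,2) homs(1)]
      by (auto simp: eqs concrete_cat_def arr_map compose_def fun_eq_iff)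
  qed (auto simp: concrete_cat_def obj arr arr_map)
qed

section \<open>Homomorphisms, primes and the nilradical without identity\<close>

lemma rng_homD:
  assumes "h \<in> rng_hom R M"
  shows "h \<in> carrier R \<rightarrow> carrier M"
    and "\<lbrakk>x \<in> carrier R; y \<in> carrier R\<rbrakk> \<Longrightarrow> h (x \<oplus>\<^bsub>R\<^esub> y) = h x \<oplus>\<^bsub>M\<^esub> h y"
    and "\<lbrakk>x \<in> carrier R; y \<in> carrier R\<rbrakk> \<Longrightarrow> h (x \<otimes>\<^bsub>R\<^esub> y) = h x \<otimes>\<^bsub>M\<^esub> h y"
  using assms by (auto simp: rng_hom_def)

lemma (in comm_rng) rng_idealI:
  assumes "I \<subseteq> carrier R" "\<zero> \<in> I"
    and "\<And>x y. \<lbrakk>x \<in> I; y \<in> I\<rbrakk> \<Longrightarrow> x \<oplus> y \<in> I"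
    and "\<And>x. x \<in> I \<Longrightarrow> \<ominus> x \<in> I"
    and "\<And>a x. \<lbrakk>a \<in> I; x \<in> carrier R\<rbrakk> \<Longrightarrow> x \<otimes> a \<in> I"
  shows "rng_ideal I R"
proof (intro rng_ideal.intro rng_ideal_axioms.intro additive_subgroup.intro comm_rng_axioms)
  show "subgroup I (add_monoid R)"
    using assms(1-4) by (intro subgroup.intro) (auto simp: a_inv_def)
qed (rule assms(5))

text \<open>Supplies preservation of zero and negatives, which \<open>rng_hom\<close> does not state
  but which additivity between groups forces.\<close>

lemma (in comm_rng) abelian_group_hom_rng_hom:
  assumes M: "comm_rng M" and h: "h \<in> rng_hom R M"
  shows "abelian_group_hom R M h"
proof -
  interpret M: comm_rng M by (rule M)
  show ?thesis
    using rng_homD[OF h]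
    by (intro abelian_group_homI abelian_group_axioms M.abelian_group_axioms)
       (auto simp: group_hom_def group_hom_axioms_def hom_def a_group M.a_group)
qed

lemma (in comm_rng) rng_primeideal_vimage:
  assumes T: "comm_rng T" and h: "h \<in> rng_hom R T" and onto: "h ` carrier R = carrier T"
    and P: "rng_primeideal P T"
  shows "rng_primeideal {x \<in> carrier R. h x \<in> P} R"
proof -
  interpret T: comm_rng T by (rule T)
  interpret P: rng_primeideal P T by (rule P)
  interpret h: abelian_group_hom R T h
    by (rule abelian_group_hom_rng_hom[OF T h])
  note hD = rng_homD[OF h]
  show ?thesis
  proof (intro rng_primeideal.intro rng_primeideal_axioms.intro rng_idealI)
    \<comment> \<open>With no identity at hand, \<open>1 \<notin> P\<close> cannot be pulled back;
      instead, a preimage equal to \<open>carrier R\<close> would give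
      \<open>carrier T \<subseteq> P\<close> by \<open>onto\<close>.\<close>
    show "{x \<in> carrier R. h x \<in> P} \<noteq> carrier R"
    proof
      assume "{x \<in> carrier R. h x \<in> P} = carrier R"
      then have "h ` carrier R \<subseteq> P" by auto
      then show False
        using P.rng_P_proper P.a_subset onto by auto
    qed
  next
    fix a x assume "a \<in> {x \<in> carrier R. h x \<in> P}" "x \<in> carrier R"
    then show "x \<otimes> a \<in> {x \<in> carrier R. h x \<in> P}"
      using hD by (simp add: rng_m_closed P.rng_I_closed)
  next
    fix a b assume "a \<in> carrier R" "b \<in> carrier R" "a \<otimes> b \<in> {x \<in> carrier R. h x \<in> P}"
    then show "a \<in> {x \<in> carrier R. h x \<in> P} \<or> b \<in> {x \<in> carrier R. h x \<in> P}"
      using hD P.rng_P_prime[of "h a" "h b"] by simp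
  qed simp_all
qed

text \<open>An element of all primes of \<open>S\<close> lies in the preimage of each prime of
  \<open>T\<close>. If \<open>T\<close> has no primes, only \<open>h x \<in> carrier T\<close>
  remains.\<close>

lemma rng_hom_nilradical:
  assumes S: "comm_rng S" and T: "comm_rng T" and h: "h \<in> rng_hom S T"
    and onto: "h ` carrier S = carrier T" and x: "x \<in> nilradical S"
  shows "h x \<in> nilradical T"
  using comm_rng.rng_primeideal_vimage[OF S T h onto] x onto
  by (auto simp: nilradical_def)

lemma (in comm_rng) rng_ideal_nilradical: "rng_ideal (nilradical R) R"
proof -
  \<comment> \<open>Stated for an arbitrary prime, so that each law applies to all members of the
    intersection.\<close>
  have P: "additive_subgroup P R" "\<And>a x. \<lbrakk>a \<in> P; x \<in> carrier R\<rbrakk> \<Longrightarrow> x \<otimes> a \<in> P"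
    if "rng_primeideal P R" for P
  proof -
    interpret P: rng_primeideal P R by (rule that)
    show "additive_subgroup P R" by (rule P.additive_subgroup_axioms)
    show "x \<otimes> a \<in> P" if "a \<in> P" "x \<in> carrier R" for a x
      using that by (rule P.rng_I_closed)
  qed
  show ?thesis
    unfolding nilradical_def
    using additive_subgroup.zero_closed[OF P(1)] additive_subgroup.a_closed[OF P(1)]
      additive_subgroup.a_inv_closed[OF P(1)] P(2)
    by (intro rng_idealI) (simp_all add: rng_m_closed)
qed

text \<open>The additive part is the subgroup theorem for groups; products stay in \<open>I\<close>
  by absorption. The element \<open>one\<close> of the record may lie outside \<open>I\<close>, so
  in general no \<open>cring\<close> results.\<close>

lemma (in rng_ideal) comm_rng_carrier_update: "comm_rng (R\<lparr>carrier := I\<rparr>)"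
proof -
  have I: "x \<in> carrier R" if "x \<in> I" for x
    using that by (rule a_Hcarr)
  have "group ((add_monoid R)\<lparr>carrier := I\<rparr>)"
    by (rule subgroup.subgroup_is_group[OF a_subgroup a_group])
  then have "comm_group ((add_monoid R)\<lparr>carrier := I\<rparr>)"
    by (rule group.group_comm_groupI) (simp add: I a_comm)
  then have "abelian_group (R\<lparr>carrier := I\<rparr>)"
    by (intro abelian_group.intro abelian_monoid.intro abelian_group_axioms.intro)
       (simp_all add: comm_group_def)
  then show ?thesis
  proof (intro comm_rng.intro comm_rng_axioms.intro)
    fix x y assume "x \<in> carrier (R\<lparr>carrier := I\<rparr>)" "y \<in> carrier (R\<lparr>carrier := I\<rparr>)"
    then show "x \<otimes>\<^bsub>R\<lparr>carrier := I\<rparr>\<^esub> y = y \<otimes>\<^bsub>R\<lparr>carrier := I\<rparr>\<^esub> x"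
      using rng_m_comm[of x y] by (simp add: I)
  qed (simp_all add: I rng_m_assoc rng_l_distr rng_I_closed)
qed

section \<open>The ideal \<open>psi\<close> and the values of \<open>chi\<close> on objects and
  maps\<close>

lemma rng_ideal_psi:
  assumes R: "cring R" and ext: "i_extension S R" and I: "rng_ideal I S"
  shows "rng_ideal (psi (S, R) I) R"
proof -
  interpret R: cring R by (rule R)
  interpret i_extension S R by (rule ext)
  interpret S: rng_ideal "carrier S" R by (rule carrier_ideal)
  interpret I: rng_ideal I S by (rule I)
  have [simp]: "s \<in> carrier R" if "s \<in> carrier S" for s
    using that by (rule S.a_Hcarr)
  show ?thesis
  proof (rule R.rng_idealI)
    show "psi (S, R) I \<subseteq> carrier R" by (auto simp: psi_def)
    show "\<zero>\<^bsub>R\<^esub> \<in> psi (S, R) I"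
      using I.zero_closed zero_eq by (auto simp: psi_def)
  next
    fix x y assume "x \<in> psi (S, R) I" "y \<in> psi (S, R) I"
    then have "x \<in> carrier R" "y \<in> carrier R"
      and xy: "\<And>s. s \<in> carrier S \<Longrightarrow> x \<otimes>\<^bsub>R\<^esub> s \<in> I" "\<And>s. s \<in> carrier S \<Longrightarrow> y \<otimes>\<^bsub>R\<^esub> s \<in> I"
      by (auto simp: psi_def)
    \<comment> \<open>Distributivity gives a sum formed in \<open>R\<close>, whereas
      \<open>I\<close> is closed under the addition of \<open>S\<close>; \<open>add_eq\<close>
      identifies the two on \<open>I\<close>.\<close>
    then show "x \<oplus>\<^bsub>R\<^esub> y \<in> psi (S, R) I"
      using I.a_closed[OF xy]
      by (auto simp: psi_def R.l_distr add_eq[OF I.a_Hcarr I.a_Hcarr] xy)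
  next
    fix x assume "x \<in> psi (S, R) I"
    then have x: "x \<in> carrier R" "\<And>s. s \<in> carrier S \<Longrightarrow> x \<otimes>\<^bsub>R\<^esub> s \<in> I"
      by (auto simp: psi_def)
    \<comment> \<open>The sign moves to the other factor: \<open>(-x) s = x (-s)\<close>, and
      \<open>-s\<close> is again in \<open>S\<close>. Thus negatives of \<open>S\<close> and of
      \<open>R\<close> need not be compared.\<close>
    have "(\<ominus>\<^bsub>R\<^esub> x) \<otimes>\<^bsub>R\<^esub> s \<in> I" if "s \<in> carrier S" for s
      using x(2)[OF S.a_inv_closed[OF that]] x(1) that by (simp add: R.l_minus R.r_minus)
    then show "\<ominus>\<^bsub>R\<^esub> x \<in> psi (S, R) I"
      using x(1) by (simp add: psi_def)
  next
    fix a x assume "a \<in> psi (S, R) I" and x: "x \<in> carrier R"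
    then have a: "a \<in> carrier R" "\<And>s. s \<in> carrier S \<Longrightarrow> a \<otimes>\<^bsub>R\<^esub> s \<in> I"
      by (auto simp: psi_def)
    \<comment> \<open>\<open>I\<close> absorbs factors from \<open>S\<close> only, so
      \<open>x\<close> is absorbed by \<open>S\<close> instead: \<open>(x a) s = a (x s)\<close>
      with \<open>x s\<close> in \<open>S\<close>.\<close>
    have "(x \<otimes>\<^bsub>R\<^esub> a) \<otimes>\<^bsub>R\<^esub> s \<in> I" if "s \<in> carrier S" for s
      using a(2)[OF S.rng_I_closed[OF that x]] a(1) x that by (simp add: R.m_ac)
    then show "x \<otimes>\<^bsub>R\<^esub> a \<in> psi (S, R) I"
      using a(1) x by (auto simp: psi_def)
  qed
qed

lemma carrier_chi_obj: "carrier (chi_obj (S, R)) = psi (S, R) (nilradical S)"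
  by (simp add: chi_obj_def)

lemma rng_ideal_chi_obj:
  assumes "cring R" "i_extension S R"
  shows "rng_ideal (carrier (chi_obj (S, R))) R"
proof -
  interpret i_extension S R by (rule assms)
  show ?thesis
    unfolding carrier_chi_obj by (intro rng_ideal_psi assms S.rng_ideal_nilradical)
qed

lemma carrier_chi_obj_subset: "carrier (chi_obj (S, R)) \<subseteq> carrier R"
  by (auto simp: carrier_chi_obj psi_def)

lemma comm_rng_chi_obj:
  assumes "cring R" "i_extension S R"
  shows "comm_rng (chi_obj (S, R))"
  using rng_ideal.comm_rng_carrier_update[OF rng_ideal_chi_obj[OF assms]]
  by (simp add: chi_obj_def)

text \<open>For restrictions to \<open>psi\<close>: at a sum or product they agree with the original
  map only if that element lies in \<open>psi\<close>.\<close>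

lemma chi_obj_closed:
  assumes "cring R" "i_extension S R"
    and "x \<in> carrier (chi_obj (S, R))" "y \<in> carrier (chi_obj (S, R))"
  shows "x \<oplus>\<^bsub>R\<^esub> y \<in> carrier (chi_obj (S, R))" and "x \<otimes>\<^bsub>R\<^esub> y \<in> carrier (chi_obj (S, R))"
proof -
  interpret rng_ideal "carrier (chi_obj (S, R))" R by (rule rng_ideal_chi_obj[OF assms(1,2)])
  show "x \<oplus>\<^bsub>R\<^esub> y \<in> carrier (chi_obj (S, R))" "x \<otimes>\<^bsub>R\<^esub> y \<in> carrier (chi_obj (S, R))"
    using assms(3,4) by (auto intro: a_closed rng_I_closed a_Hcarr)
qed

lemma ring_hom_chi_obj:
  assumes ext: "i_extension S R" "i_extension T M"
    and h: "h \<in> ring_hom R M" and onto: "h ` carrier S = carrier T"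
  shows "h \<in> carrier (chi_obj (S, R)) \<rightarrow> carrier (chi_obj (T, M))"
proof
  interpret SR: i_extension S R by (rule ext)
  interpret TM: i_extension T M by (rule ext)
  interpret S: rng_ideal "carrier S" R by (rule SR.carrier_ideal)
  have hT: "h s \<in> carrier T" if "s \<in> carrier S" for s
    using that onto by auto
  \<comment> \<open>The nilradicals are formed from primes of \<open>S\<close> and \<open>T\<close>,
    not of \<open>R\<close> and \<open>M\<close>, so \<open>h\<close> has to be seen as a map
    between the ideals, whose operations are inherited.\<close>
  have hS: "h \<in> rng_hom S T"
    using hT by (auto simp: rng_hom_def SR.add_eq SR.mult_eq TM.add_eq TM.mult_eq
        ring_hom_add[OF h] ring_hom_mult[OF h] S.a_Hcarr)
  fix x assume "x \<in> carrier (chi_obj (S, R))"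
  then have x: "x \<in> carrier R" "\<And>s. s \<in> carrier S \<Longrightarrow> x \<otimes>\<^bsub>R\<^esub> s \<in> nilradical S"
    by (auto simp: carrier_chi_obj psi_def)
  have "h x \<otimes>\<^bsub>M\<^esub> t \<in> nilradical T" if t: "t \<in> carrier T" for t
  proof -
    obtain s where s: "s \<in> carrier S" "t = h s" using t onto by auto
    have "h (x \<otimes>\<^bsub>R\<^esub> s) \<in> nilradical T"
      using SR.S.comm_rng_axioms TM.S.comm_rng_axioms hS onto x(2)[OF s(1)]
      by (rule rng_hom_nilradical)
    then show ?thesis using s x(1) by (simp add: ring_hom_mult[OF h] S.a_Hcarr)
  qed
  then show "h x \<in> carrier (chi_obj (T, M))"
    using x(1) ring_hom_closed[OF h] by (auto simp: carrier_chi_obj psi_def)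
qed

section \<open>The two categories\<close>

lemma category_CR: "category CR"
  unfolding CR_def
proof (rule category_concrete_cat)
  fix R :: "'a ring" assume "R \<in> {R. comm_rng R}"
  then interpret comm_rng R by simp
  show "(\<lambda>a\<in>carrier R. a) \<in> rng_hom R R"
    by (auto simp: rng_hom_def rng_m_closed)
next
  fix R M L :: "'a ring" and f g
  assume "R \<in> {R. comm_rng R}" and f: "f \<in> rng_hom R M" and g: "g \<in> rng_hom M L"
  then interpret comm_rng R by simp
  show "compose (carrier R) g f \<in> rng_hom R L"
    using rng_homD[OF f] rng_homD[OF g]
    by (auto simp: rng_hom_def compose_def rng_m_closed Pi_iff)
qed (auto simp: rng_hom_def)

lemma category_E_cat: "category E_cat"
  unfolding E_cat_def
proof (rule category_concrete_cat; clarify)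
  fix S R :: "'a ring" assume "cring R" and ext: "i_extension S R"
  then interpret R: cring R by simp
  interpret i_extension S R by (rule ext)
  interpret S: rng_ideal "carrier S" R by (rule carrier_ideal)
  show "(\<lambda>a\<in>carrier R. a) \<in> ring_hom R R \<and> (\<lambda>a\<in>carrier R. a) ` carrier S = carrier S"
    using S.a_subset by (auto simp: ring_hom_def image_iff)
next
  fix S1 R1 S2 R2 S3 R3 :: "'a ring" and f g
  assume R: "cring R1" "i_extension S1 R1"
    and f: "f \<in> ring_hom R1 R2" "f ` carrier S1 = carrier S2"
    and g: "g \<in> ring_hom R2 R3" "g ` carrier S2 = carrier S3"
  interpret R: cring R1 by (rule R)
  interpret i_extension S1 R1 by (rule R)
  interpret S: rng_ideal "carrier S1" R1 by (rule carrier_ideal)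
  \<comment> \<open>\<open>compose\<close> is the true composite only on \<open>carrier R1\<close>,
    which contains the ideal \<open>carrier S1\<close>.\<close>
  have "compose (carrier R1) g f ` carrier S1 = g ` f ` carrier S1"
    using S.a_subset by (force simp: compose_def image_iff)
  then show "compose (carrier R1) g f \<in> ring_hom R1 R3 \<and>
      compose (carrier R1) g f ` carrier S1 = carrier S3"
    using f g by (auto simp: ring_hom_def compose_def Pi_iff)
qed (auto simp: ring_hom_def)

section \<open>The functors \<open>chi\<close> and \<open>V\<close>\<close>

lemma chi_functor_cat_functor: "cat_functor E_cat CR chi_functor"
  unfolding E_cat_def CR_def
\<comment> \<open>The rule needs the categories unfolded; folding back lets
  \<open>category_E_cat\<close> and \<open>category_CR\<close> settle its first two
  premises.\<close>
proof (rule cat_functor_concrete_restrict; (fold E_cat_def CR_def)?)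
  fix x y :: "'a ring \<times> 'a ring" and f
  assume "x \<in> {(S, R). cring R \<and> i_extension S R}" "y \<in> {(S, R). cring R \<and> i_extension S R}"
    and "f \<in> (case x of (S1, R1) \<Rightarrow> \<lambda>(S2, R2).
      {h \<in> ring_hom R1 R2. h ` carrier S1 = carrier S2}) y"
  then obtain S R T M where xy: "x = (S, R)" "y = (T, M)"
    and R: "cring R" "i_extension S R" and M: "cring M" "i_extension T M"
    and f: "f \<in> ring_hom R M" "f ` carrier S = carrier T"
    by (cases x; cases y) auto
  note maps = ring_hom_chi_obj[OF R(2) M(2) f]
  show "f \<in> (case x of (S, R) \<Rightarrow> carrier R) \<rightarrow> (case y of (S, R) \<Rightarrow> carrier R)"
    using f by (auto simp: xy ring_hom_def)
  show "f \<in> carrier (obj_map chi_functor x) \<rightarrow> carrier (obj_map chi_functor y)"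
    using maps by (simp add: xy chi_functor_def)
  have ops: "add (chi_obj (S, R)) = add R" "mult (chi_obj (S, R)) = mult R"
      "add (chi_obj (T, M)) = add M" "mult (chi_obj (T, M)) = mult M"
    by (simp_all add: chi_obj_def)
  have "restrict f (carrier (chi_obj (S, R))) \<in> rng_hom (chi_obj (S, R)) (chi_obj (T, M))"
    using maps chi_obj_closed[OF R] carrier_chi_obj_subset[of S R]
    by (auto simp: rng_hom_def ops subset_iff ring_hom_add[OF f(1)] ring_hom_mult[OF f(1)])
  then show "restrict f (carrier (obj_map chi_functor x))
      \<in> rng_hom (obj_map chi_functor x) (obj_map chi_functor y)"
    by (simp add: xy chi_functor_def)
qed (auto simp: category_E_cat category_CR chi_functor_def
    intro: comm_rng_chi_obj carrier_chi_obj_subset[THEN subsetD])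

text \<open>Here the image object has the full carrier of \<open>R\<close>, so the restriction in
  the general rule leaves extensional maps unchanged.\<close>

lemma V_functor_cat_functor: "cat_functor E_cat CR V_functor"
  unfolding E_cat_def CR_def
proof (rule cat_functor_concrete_restrict; (fold E_cat_def CR_def)?)
  fix x y :: "'a ring \<times> 'a ring" and f
  assume "x \<in> {(S, R). cring R \<and> i_extension S R}"
    and "f \<in> (case x of (S1, R1) \<Rightarrow> \<lambda>(S2, R2).
      {h \<in> ring_hom R1 R2. h ` carrier S1 = carrier S2}) y"
  then obtain S R T M where xy: "x = (S, R)" "y = (T, M)"
    and R: "cring R" and f: "f \<in> ring_hom R M"
    by (cases x; cases y) auto
  interpret R: cring R by (rule R)
  show "restrict f (carrier (obj_map V_functor x))
      \<in> rng_hom (obj_map V_functor x) (obj_map V_functor y)"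
    using f by (auto simp: xy V_functor_def rng_hom_def ring_hom_def)
qed (auto simp: category_E_cat category_CR V_functor_def extensional_restrict ring_hom_def
    intro: cring_imp_comm_rng)

section \<open>Naturality of the inclusions\<close>

theorem proposition13:
  shows "natural_transformation (E_cat :: ('a ring \<times> 'a ring, ('a ring \<times> 'a ring, 'a) arrow) cat)
    CR chi_functor V_functor j_inclusion"
proof -
  interpret chi: cat_functor "E_cat :: ('a ring \<times> 'a ring, ('a ring \<times> 'a ring, 'a) arrow) cat"
    CR chi_functor by (rule chi_functor_cat_functor)
  interpret V: cat_functor "E_cat :: ('a ring \<times> 'a ring, ('a ring \<times> 'a ring, 'a) arrow) cat"
    CR V_functor by (rule V_functor_cat_functor)
  show ?thesis
  proof
    fix x :: "'a ring \<times> 'a ring" assume "x \<in> Obj E_cat"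
    then obtain S R where x: "x = (S, R)" and R: "cring R" "i_extension S R"
      by (auto simp: E_cat_def concrete_cat_def)
    have "(\<lambda>a\<in>carrier (chi_obj (S, R)). a) \<in> rng_hom (chi_obj (S, R)) R"
      using chi_obj_closed[OF R] carrier_chi_obj_subset[of S R]
      by (auto simp: rng_hom_def chi_obj_def)
    then show "j_inclusion x \<in> Arr CR"
      using comm_rng_chi_obj[OF R] cring_imp_comm_rng[OF R(1)]
      by (auto simp: x CR_def concrete_cat_def j_inclusion_def carrier_chi_obj)
    show "Dom CR (j_inclusion x) = obj_map chi_functor x"
      and "Cod CR (j_inclusion x) = obj_map V_functor x"
      by (auto simp: x CR_def concrete_cat_def j_inclusion_def chi_functor_def V_functor_def)
  next
    fix f :: "('a ring \<times> 'a ring, 'a) arrow" assume "f \<in> Arr E_cat"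
    then obtain S R T M h where f: "f = Arrow (S, R) (T, M) h"
      and ext: "i_extension S R" "i_extension T M"
      and h: "h \<in> ring_hom R M" "h ` carrier S = carrier T"
      by (auto simp: E_cat_def concrete_cat_def)
    \<comment> \<open>Both sides are \<open>h\<close> restricted to
      \<open>psi (S, R) (nilradical S)\<close>. On the left this uses that \<open>h\<close> lands in
      \<open>psi (T, M) (nilradical T)\<close>, outside of which the inclusion is
      \<open>undefined\<close>.\<close>
    show "Comp CR (j_inclusion (Cod E_cat f)) (arr_map chi_functor f) =
        Comp CR (arr_map V_functor f) (j_inclusion (Dom E_cat f))"
      using ring_hom_chi_obj[OF ext h]
      by (auto simp: f CR_def E_cat_def concrete_cat_def j_inclusion_def chi_functor_def
          V_functor_def carrier_chi_obj compose_def fun_eq_iff)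
  qed
qed

end
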